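(* Let $\Gamma$ be a countably infinite discrete sofic group with sofic approximation $\Sigma$, and let $(X,\mu)$ be a standard probability space. Suppose that $\alpha\colon\Gamma\to\mathrm{Aut}(X,\mu)$ is a homomorphism whose image is contained in a compact (for the weak topology) subgroup of $\mathrm{Aut}(X,\mu)$. Then, for the action of $\Gamma$ on $(X,\mu)$ given by $\alpha$, $$h_{\Sigma,\mu}(X,\Gamma)\leq0.$$
   Context: $\mathrm{Aut}(X,\mu)$ is the group of measure-preserving automorphisms of $(X,\mu)$ (modulo a.e. equality). The weak topology on it has as basic neighborhoods of $\alpha$ the sets $\bigcap_{j=1}^n\{\beta\in\mathrm{Aut}(X,\mu):\mu(\beta^{-1}(A_j)\Delta\alpha^{-1}(A_j))<\varepsilon\}$, for measurable $A_1,\dots,A_n\subseteq X$ and $\varepsilon>0$. Sofic approximations. $u_d$ is the uniform probability measure on $\{1,\dots,d\}$ and $S_d$ is the symmetric group. A sofic approximation of a countable discrete group $\Gamma$ is a sequence $\Sigma=(\sigma_i\colon\Gamma\to S_{d_i})$ of functions (not assumed homomorphisms) such that $u_{d_i}(\{k:\sigma_i(g)\sigma_i(h)(k)=\sigma_i(gh)(k)\})\to1$ for all $g,h\in\Gamma$ and $u_{d_i}(\{k:\sigma_i(g)(k)\neq\sigma_i(h)(k)\})\to1$ for all $g\neq h$ in $\Gamma$. $\Gamma$ is sofic if it has a sofic approximation. Sofic measure entropy (Bowen, Kerr–Li; in Kerr's formulation). A finite observable on $X$ is a measurable map $\alpha\colon X\to A$ with $A$ finite. A finite observable $\beta\colon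 X\to B$ refines $\alpha$, written $\alpha\le\beta$, if there is $\pi\colon B\to A$ with $\pi(\beta(x))=\alpha(x)$ for a.e. $x$. For finite $F\subseteq\Gamma$, let $\widetilde{\beta}^{F}\colon X\to B^F$, $\widetilde\beta^F(x)(g)=\beta(g^{-1}x)$. For finite $F\subseteq \Gamma$ containing the identity $e$, $\delta>0$ and $\sigma\colon\Gamma\to S_d$, let $\mathrm{AP}(\beta,F,\delta,\sigma)$ be the set of all $\phi\colon\{1,\dots,d\}\to B^F$ with $$\sum_{b\in B^F}\left|u_d(\phi^{-1}(\{b\}))-\mu((\widetilde\beta^F)^{-1}(\{b\}))\right|<\delta,\qquad u_d(\{j:\phi(j)(g)\neq\phi(\sigma(g)^{-1}(j))(e)\})<\delta\ \text{ for all } g\in F.$$ Let $\pi^*\colon B^F\to A$, $\pi^*(b)=\pi(b(e))$. With $\log 0=-\infty$, put $$h_{\Sigma,\mu}(\alpha;\beta,F,\delta)=\limsup_{i\to\infty}\frac1{d_i}\log\left|\{\pi^*\circ\phi:\phi\in\mathrm{AP}(\beta,F,\delta,\sigma_i)\}\right|,\qquad h_{\Sigma,\mu}(\alpha;\beta)=\inf_{F,\delta}h_{\Sigma,\mu}(\alpha;\beta,F,\delta),$$ and $h_{\Sigma,\mu}(X,\Gamma)=\sup_\alpha\inf_{\beta\ge\alpha}h_{\Sigma,\mu}(\alpha;\beta)$, over all finite observables $\alpha$ and finite observables $\beta$ refining $\alpha$. *)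

theory Defs
  imports
    "HOL-Probability.Probability_Measure"
    "HOL-Algebra.Coset"
    "HOL-Algebra.Bij"
begin

section \<open>Standard probability spaces and their automorphism groups\<close>

definition standard_prob_space :: "'x measure \<Rightarrow> bool" where
  "standard_prob_space M \<longleftrightarrow> prob_space M \<and>
     (\<exists>T. topspace T = space M \<and> completely_metrizable_space T \<and> second_countable T \<and>
          sets M = sigma_sets (space M) {U. openin T U})"

text \<open>As in the library's \<^const>\<open>BijGroup\<close>, bijections of \<^term>\<open>space M\<close> are represented by
  extensional functions.\<close>

definition mp_bij :: "'x measure \<Rightarrow> ('x \<Rightarrow> 'x) set" where
  "mp_bij M = {T \<in> Bij (space M). T \<in> measurable M M \<and>
     inv_into (space M) T \<in> measurable M M \<and> distr M M T = M}"

definition mp_group :: "'x measure \<Rightarrow> ('x \<Rightarrow> 'x) monoid" where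
  "mp_group M = BijGroup (space M) \<lparr>carrier := mp_bij M\<rparr>"

definition ae_identities :: "'x measure \<Rightarrow> ('x \<Rightarrow> 'x) set" where
  "ae_identities M = {T \<in> mp_bij M. AE x in M. T x = x}"

text \<open>The elements of this quotient are exactly the classes of elements of \<^term>\<open>mp_bij M\<close> modulo
  almost everywhere equality; see \<open>mem_Aut_iff\<close> and \<open>Aut_class\<close> below.\<close>

definition Aut :: "'x measure \<Rightarrow> ('x \<Rightarrow> 'x) set monoid" where
  "Aut M = mp_group M Mod ae_identities M"

definition aut_rep :: "('x \<Rightarrow> 'x) set \<Rightarrow> 'x \<Rightarrow> 'x" where
  "aut_rep a = (SOME T. T \<in> a)"

definition aut_preimage :: "'x measure \<Rightarrow> ('x \<Rightarrow> 'x) set \<Rightarrow> 'x set \<Rightarrow> 'x set" where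
  "aut_preimage M a A = aut_rep a -` A \<inter> space M"

lemma mp_bij_compose:
  assumes "S \<in> mp_bij M" "T \<in> mp_bij M"
  shows "compose (space M) S T \<in> mp_bij M"
proof -
  let ?X = "space M"
  have S: "S \<in> Bij ?X" "S \<in> measurable M M" "inv_into ?X S \<in> measurable M M" "distr M M S = M"
    and T: "T \<in> Bij ?X" "T \<in> measurable M M" "inv_into ?X T \<in> measurable M M" "distr M M T = M"
    using assms by (auto simp: mp_bij_def)
  have bS: "bij_betw S ?X ?X" and bT: "bij_betw T ?X ?X"
    using S(1) T(1) by (auto simp: Bij_def)
  have B: "compose ?X S T \<in> Bij ?X" using S T by (simp add: compose_Bij)
  have eq: "compose ?X S T x = (S \<circ> T) x" if "x \<in> ?X" for x using that by (simp add: compose_def)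
  have m: "compose ?X S T \<in> measurable M M"
    using measurable_comp[OF T(2) S(2)] eq by (simp cong: measurable_cong)
  have inv: "inv_into ?X (compose ?X S T) x = (inv_into ?X T \<circ> inv_into ?X S) x" if x: "x \<in> ?X" for x
  proof (rule inv_into_f_eq)
    show "inj_on (compose ?X S T) ?X" using B by (auto simp: Bij_def bij_betw_def)
    have 1: "inv_into ?X S x \<in> ?X" using bS x by (metis bij_betw_def inv_into_into)
    show 2: "(inv_into ?X T \<circ> inv_into ?X S) x \<in> ?X"
      using bT 1 by (metis bij_betw_def inv_into_into comp_apply)
    show "compose ?X S T ((inv_into ?X T \<circ> inv_into ?X S) x) = x"
      using 1 2 x bS bT by (simp add: compose_def bij_betw_inv_into_right)
  qed
  have mi: "inv_into ?X (compose ?X S T) \<in> measurable M M"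
    using measurable_comp[OF S(3) T(3)] inv by (simp cong: measurable_cong)
  have "distr M M (compose ?X S T) = distr M M (S \<circ> T)"
    by (rule distr_cong) (use eq in auto)
  also have "\<dots> = distr (distr M M T) M S" by (rule distr_distr[symmetric, OF S(2) T(2)])
  also have "\<dots> = M" by (simp only: S(4) T(4))
  finally show ?thesis using B m mi by (auto simp: mp_bij_def)
qed

lemma mp_bij_inverse:
  assumes "T \<in> mp_bij M"
  shows "restrict (inv_into (space M) T) (space M) \<in> mp_bij M"
proof -
  let ?X = "space M" and ?I = "restrict (inv_into (space M) T) (space M)"
  have T: "T \<in> Bij ?X" "T \<in> measurable M M" "inv_into ?X T \<in> measurable M M" "distr M M T = M"
    using assms by (auto simp: mp_bij_def)
  have bT: "bij_betw T ?X ?X" using T by (auto simp: Bij_def)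
  have B: "?I \<in> Bij ?X" using T by (rule_tac restrict_inv_into_Bij)
  have m: "?I \<in> measurable M M" using T(3) by (simp cong: measurable_cong)
  have inv: "inv_into ?X ?I x = T x" if x: "x \<in> ?X" for x
  proof (rule inv_into_f_eq)
    show "inj_on ?I ?X" using B by (auto simp: Bij_def bij_betw_def)
    show 1: "T x \<in> ?X" using bT x by (auto simp: bij_betw_def)
    show "?I (T x) = x" using 1 x bT by (simp add: bij_betw_inv_into_left)
  qed
  have mi: "inv_into ?X ?I \<in> measurable M M"
    using T(2) inv by (simp cong: measurable_cong)
  have "distr M M ?I = distr (distr M M T) M ?I" by (simp only: T(4))
  also have "\<dots> = distr M M (?I \<circ> T)" by (rule distr_distr[OF m T(2)])
  also have "\<dots> = distr M M (\<lambda>x. x)"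
  proof (rule distr_cong)
    fix x assume "x \<in> ?X"
    then show "(?I \<circ> T) x = x"
      using bT measurable_space[OF T(2)] by (simp add: bij_betw_inv_into_left)
  qed auto
  also have "\<dots> = M" by (simp add: distr_id)
  finally show ?thesis using B m mi by (auto simp: mp_bij_def)
qed

lemma mp_bij_id: "(\<lambda>x\<in>space M. x) \<in> mp_bij M"
proof -
  let ?X = "space M"
  have m: "(\<lambda>x\<in>?X. x) \<in> measurable M M" by (simp cong: measurable_cong)
  have inv: "inv_into ?X (\<lambda>x\<in>?X. x) x = x" if "x \<in> ?X" for x
    by (rule inv_into_f_eq) (use that in \<open>auto simp: inj_on_def\<close>)
  have mi: "inv_into ?X (\<lambda>x\<in>?X. x) \<in> measurable M M" using inv by (simp cong: measurable_cong)
  have "distr M M (\<lambda>x\<in>?X. x) = distr M M (\<lambda>x. x)" by (rule distr_cong) auto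
  then show ?thesis using m mi by (simp add: mp_bij_def id_Bij distr_id)
qed

lemma subgroup_mp_bij: "subgroup (mp_bij M) (BijGroup (space M))"
proof (rule group.subgroupI[OF group_BijGroup])
  show "mp_bij M \<subseteq> carrier (BijGroup (space M))" by (auto simp: mp_bij_def BijGroup_def)
  show "mp_bij M \<noteq> {}" using mp_bij_id by blast
next
  fix T assume T: "T \<in> mp_bij M"
  then have "T \<in> Bij (space M)" by (auto simp: mp_bij_def)
  then have "inv\<^bsub>BijGroup (space M)\<^esub> T = restrict (inv_into (space M) T) (space M)"
    by (rule inv_BijGroup)
  then show "inv\<^bsub>BijGroup (space M)\<^esub> T \<in> mp_bij M" using mp_bij_inverse[OF T] by simp
next
  fix S T assume "S \<in> mp_bij M" "T \<in> mp_bij M"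
  moreover from this have "S \<in> Bij (space M)" "T \<in> Bij (space M)" by (auto simp: mp_bij_def)
  ultimately show "S \<otimes>\<^bsub>BijGroup (space M)\<^esub> T \<in> mp_bij M"
    by (simp add: BijGroup_def mp_bij_compose)
qed

lemma group_mp_group: "group (mp_group M)"
  unfolding mp_group_def
  using group.subgroup_imp_group[OF group_BijGroup subgroup_mp_bij] .

lemma carrier_mp_group [simp]: "carrier (mp_group M) = mp_bij M"
  by (simp add: mp_group_def)

lemma mult_mp_group:
  "S \<in> mp_bij M \<Longrightarrow> T \<in> mp_bij M \<Longrightarrow> S \<otimes>\<^bsub>mp_group M\<^esub> T = compose (space M) S T"
  by (simp add: mp_group_def BijGroup_def mp_bij_def)

lemma one_mp_group: "\<one>\<^bsub>mp_group M\<^esub> = (\<lambda>x\<in>space M. x)"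
  by (simp add: mp_group_def BijGroup_def)

lemma inv_mp_group:
  assumes "T \<in> mp_bij M"
  shows "inv\<^bsub>mp_group M\<^esub> T = restrict (inv_into (space M) T) (space M)"
proof -
  have "T \<in> Bij (space M)" using assms by (auto simp: mp_bij_def)
  then show ?thesis unfolding mp_group_def
    using group.m_inv_consistent[OF group_BijGroup subgroup_mp_bij assms]
    by (simp add: inv_BijGroup)
qed

lemma AE_mp_bij:
  assumes "T \<in> mp_bij M" "AE x in M. P x"
  shows "AE x in M. P (T x)"
proof -
  have T: "T \<in> measurable M M" "distr M M T = M" using assms by (auto simp: mp_bij_def)
  have "AE x in distr M M T. P x" by (simp only: T(2) assms(2))
  then show ?thesis by (rule AE_distrD[OF T(1)])
qed

lemma normal_ae_identities: "ae_identities M \<lhd> mp_group M"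
proof -
  interpret G: group "mp_group M" by (rule group_mp_group)
  let ?X = "space M"
  have sub: "subgroup (ae_identities M) (mp_group M)"
  proof (rule G.subgroupI)
    show "ae_identities M \<subseteq> carrier (mp_group M)" by (auto simp: ae_identities_def)
    have "(\<lambda>x\<in>?X. x) \<in> ae_identities M" by (auto simp: ae_identities_def mp_bij_id)
    then show "ae_identities M \<noteq> {}" by blast
  next
    fix T assume T: "T \<in> ae_identities M"
    then have Tm: "T \<in> mp_bij M" and ae: "AE x in M. T x = x" by (auto simp: ae_identities_def)
    have bT: "bij_betw T ?X ?X" using Tm by (auto simp: mp_bij_def Bij_def)
    have "AE x in M. restrict (inv_into ?X T) ?X x = x"
      using ae AE_space
      by eventually_elim (metis bT bij_betw_inv_into_left restrict_apply)
    then show "inv\<^bsub>mp_group M\<^esub> T \<in> ae_identities M"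
      using mp_bij_inverse[OF Tm] by (simp add: inv_mp_group[OF Tm] ae_identities_def)
  next
    fix S T assume "S \<in> ae_identities M" "T \<in> ae_identities M"
    then have S: "S \<in> mp_bij M" "AE x in M. S x = x" and T: "T \<in> mp_bij M" "AE x in M. T x = x"
      by (auto simp: ae_identities_def)
    have "AE x in M. compose ?X S T x = x"
      using S(2) T(2) AE_space by eventually_elim (simp add: compose_def)
    then show "S \<otimes>\<^bsub>mp_group M\<^esub> T \<in> ae_identities M"
      using S T by (simp add: mult_mp_group ae_identities_def mp_bij_compose)
  qed
  show ?thesis
  proof (rule G.normal_invI[OF sub])
    fix T N assume T': "T \<in> carrier (mp_group M)" and N': "N \<in> ae_identities M"
    have T: "T \<in> mp_bij M" and N: "N \<in> mp_bij M" "AE x in M. N x = x"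
      using T' N' by (auto simp: ae_identities_def)
    let ?I = "restrict (inv_into ?X T) ?X"
    have I: "?I \<in> mp_bij M" by (rule mp_bij_inverse[OF T])
    have bT: "bij_betw T ?X ?X" using T by (auto simp: mp_bij_def Bij_def)
    have TN: "compose ?X T N \<in> mp_bij M" by (rule mp_bij_compose[OF T N(1)])
    have eq: "T \<otimes>\<^bsub>mp_group M\<^esub> N \<otimes>\<^bsub>mp_group M\<^esub> inv\<^bsub>mp_group M\<^esub> T
        = compose ?X (compose ?X T N) ?I"
      using T N I TN by (simp add: inv_mp_group mult_mp_group)
    have "AE x in M. N (?I x) = ?I x" by (rule AE_mp_bij[OF I N(2)])
    then have "AE x in M. compose ?X (compose ?X T N) ?I x = x"
      using AE_space
    proof eventually_elim
      case (elim x)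
      have "?I x \<in> ?X" using elim bT by (simp add: bij_betw_def inv_into_into)
      then show ?case using elim bT by (simp add: compose_def bij_betw_inv_into_right)
    qed
    then show "T \<otimes>\<^bsub>mp_group M\<^esub> N \<otimes>\<^bsub>mp_group M\<^esub> inv\<^bsub>mp_group M\<^esub> T \<in> ae_identities M"
      unfolding eq using mp_bij_compose[OF TN I] by (simp add: ae_identities_def)
  qed
qed

lemma group_Aut: "group (Aut M)"
  unfolding Aut_def by (rule normal.factorgroup_is_group[OF normal_ae_identities])

lemma Aut_class:
  assumes T: "T \<in> mp_bij M"
  shows "ae_identities M #>\<^bsub>mp_group M\<^esub> T = {S \<in> mp_bij M. AE x in M. S x = T x}"
proof -
  interpret G: group "mp_group M" by (rule group_mp_group)
  let ?X = "space M"
  let ?I = "restrict (inv_into ?X T) ?X"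
  have I: "?I \<in> mp_bij M" by (rule mp_bij_inverse[OF T])
  have bT: "bij_betw T ?X ?X" using T by (auto simp: mp_bij_def Bij_def)
  show ?thesis
  proof (intro equalityI subsetI)
    fix S assume "S \<in> ae_identities M #>\<^bsub>mp_group M\<^esub> T"
    then obtain N where N: "N \<in> mp_bij M" "AE x in M. N x = x" and S: "S = compose ?X N T"
      using T by (auto simp: r_coset_def ae_identities_def mult_mp_group)
    have "AE x in M. S x = T x"
      using AE_mp_bij[OF T N(2)] AE_space by eventually_elim (simp add: S compose_def)
    then show "S \<in> {S \<in> mp_bij M. AE x in M. S x = T x}"
      using mp_bij_compose[OF N(1) T] S by simp
  next
    fix S assume "S \<in> {S \<in> mp_bij M. AE x in M. S x = T x}"
    then have S: "S \<in> mp_bij M" and ae: "AE x in M. S x = T x" by auto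
    have C: "compose ?X S ?I \<in> mp_bij M" by (rule mp_bij_compose[OF S I])
    have "AE x in M. compose ?X S ?I x = x"
      using AE_mp_bij[OF I ae] AE_space
      by eventually_elim (simp add: compose_def bij_betw_inv_into_right[OF bT])
    then have "compose ?X S ?I \<in> ae_identities M" using C by (simp add: ae_identities_def)
    moreover have "S = compose ?X S ?I \<otimes>\<^bsub>mp_group M\<^esub> T"
    proof -
      have "S \<otimes>\<^bsub>mp_group M\<^esub> inv\<^bsub>mp_group M\<^esub> T \<otimes>\<^bsub>mp_group M\<^esub> T = S"
        using S T
        by (metis G.inv_closed G.l_inv G.m_assoc G.r_one carrier_mp_group)
      then show ?thesis using S I T by (simp add: inv_mp_group mult_mp_group)
    qed
    ultimately show "S \<in> ae_identities M #>\<^bsub>mp_group M\<^esub> T" by (auto simp: r_coset_def)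
  qed
qed

lemma mem_Aut_iff:
  "a \<in> carrier (Aut M) \<longleftrightarrow> (\<exists>T\<in>mp_bij M. a = {S \<in> mp_bij M. AE x in M. S x = T x})"
  unfolding Aut_def carrier_FactGroup using Aut_class by fastforce

lemma aut_rep_mem:
  assumes "a \<in> carrier (Aut M)"
  shows "aut_rep a \<in> a" "aut_rep a \<in> mp_bij M"
proof -
  obtain T where T: "T \<in> mp_bij M" "a = {S \<in> mp_bij M. AE x in M. S x = T x}"
    using assms mem_Aut_iff by blast
  then have "T \<in> a" by simp
  then show "aut_rep a \<in> a" unfolding aut_rep_def by (rule someI[of "\<lambda>T. T \<in> a"])
  then show "aut_rep a \<in> mp_bij M" using T by simp
qed

section \<open>The weak topology\<close>

definition weak_nbhd ::
  "'x measure \<Rightarrow> ('x \<Rightarrow> 'x) set \<Rightarrow> 'x set set \<Rightarrow> real \<Rightarrow> ('x \<Rightarrow> 'x) set set" where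
  "weak_nbhd M a \<A> \<epsilon> = {b \<in> carrier (Aut M).
     \<forall>A\<in>\<A>. measure M (sym_diff (aut_preimage M b A) (aut_preimage M a A)) < \<epsilon>}"

definition weak_topology :: "'x measure \<Rightarrow> ('x \<Rightarrow> 'x) set topology" where
  "weak_topology M = topology (\<lambda>U. U \<subseteq> carrier (Aut M) \<and>
     (\<forall>a\<in>U. \<exists>\<A> \<epsilon>. finite \<A> \<and> \<A> \<subseteq> sets M \<and> \<epsilon> > 0 \<and> weak_nbhd M a \<A> \<epsilon> \<subseteq> U))"

lemma openin_weak_topology:
  "openin (weak_topology M) U \<longleftrightarrow> U \<subseteq> carrier (Aut M) \<and>
     (\<forall>a\<in>U. \<exists>\<A> \<epsilon>. finite \<A> \<and> \<A> \<subseteq> sets M \<and> \<epsilon> > 0 \<and> weak_nbhd M a \<A> \<epsilon> \<subseteq> U)"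
proof -
  have "istopology (\<lambda>U. U \<subseteq> carrier (Aut M) \<and>
     (\<forall>a\<in>U. \<exists>\<A> \<epsilon>. finite \<A> \<and> \<A> \<subseteq> sets M \<and> \<epsilon> > 0 \<and> weak_nbhd M a \<A> \<epsilon> \<subseteq> U))"
    (is "istopology ?P")
    unfolding istopology_def
  proof (intro conjI allI impI)
    fix U V assume U: "?P U" and V: "?P V"
    show "U \<inter> V \<subseteq> carrier (Aut M)" using U by blast
    show "\<forall>a\<in>U \<inter> V. \<exists>\<A> \<epsilon>. finite \<A> \<and> \<A> \<subseteq> sets M \<and> \<epsilon> > 0 \<and> weak_nbhd M a \<A> \<epsilon> \<subseteq> U \<inter> V"
    proof
      fix a assume a: "a \<in> U \<inter> V"
      obtain \<A> \<epsilon> where 1: "finite \<A>" "\<A> \<subseteq> sets M" "\<epsilon> > 0" "weak_nbhd M a \<A> \<epsilon> \<subseteq> U"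
        using U a by blast
      obtain \<B> \<eta> where 2: "finite \<B>" "\<B> \<subseteq> sets M" "\<eta> > 0" "weak_nbhd M a \<B> \<eta> \<subseteq> V"
        using V a by blast
      have "weak_nbhd M a (\<A> \<union> \<B>) (min \<epsilon> \<eta>) \<subseteq> weak_nbhd M a \<A> \<epsilon> \<inter> weak_nbhd M a \<B> \<eta>"
        by (auto simp: weak_nbhd_def)
      then show "\<exists>\<A> \<epsilon>. finite \<A> \<and> \<A> \<subseteq> sets M \<and> \<epsilon> > 0 \<and> weak_nbhd M a \<A> \<epsilon> \<subseteq> U \<inter> V"
        using 1 2 by (intro exI[of _ "\<A> \<union> \<B>"] exI[of _ "min \<epsilon> \<eta>"]) auto
    qed
  next
    fix \<U> assume "\<forall>U\<in>\<U>. ?P U"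
    then show "\<Union>\<U> \<subseteq> carrier (Aut M)" "\<forall>a\<in>\<Union>\<U>. \<exists>\<A> \<epsilon>. finite \<A> \<and> \<A> \<subseteq> sets M \<and> \<epsilon> > 0 \<and> weak_nbhd M a \<A> \<epsilon> \<subseteq> \<Union>\<U>"
      by (blast, meson Union_iff Union_upper subset_trans)
  qed
  then show ?thesis by (simp add: weak_topology_def topology_inverse')
qed

section \<open>Sofic approximations\<close>

abbreviation unif :: "nat \<Rightarrow> nat measure" where
  "unif n \<equiv> uniform_count_measure {1..n}"

definition sofic_approximation ::
  "('g, 'm) monoid_scheme \<Rightarrow> (nat \<Rightarrow> nat) \<Rightarrow> (nat \<Rightarrow> 'g \<Rightarrow> nat \<Rightarrow> nat) \<Rightarrow> bool" where
  "sofic_approximation G d \<sigma> \<longleftrightarrow>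
     (\<forall>i. d i \<ge> 1 \<and> (\<forall>g\<in>carrier G. \<sigma> i g permutes {1..d i})) \<and>
     (\<forall>g\<in>carrier G. \<forall>h\<in>carrier G.
        (\<lambda>i. measure (unif (d i)) {k \<in> {1..d i}. \<sigma> i g (\<sigma> i h k) = \<sigma> i (g \<otimes>\<^bsub>G\<^esub> h) k})
          \<longlonglongrightarrow> 1) \<and>
     (\<forall>g\<in>carrier G. \<forall>h\<in>carrier G. g \<noteq> h \<longrightarrow>
        (\<lambda>i. measure (unif (d i)) {k \<in> {1..d i}. \<sigma> i g k \<noteq> \<sigma> i h k}) \<longlonglongrightarrow> 1)"

section \<open>Sofic measure entropy\<close>

text \<open>An observable is a map together with its finite alphabet, which need not be its range.\<close>

definition finite_observable :: "'x measure \<Rightarrow> 'a set \<Rightarrow> ('x \<Rightarrow> 'a) \<Rightarrow> bool" where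
  "finite_observable M A \<alpha> \<longleftrightarrow> finite A \<and> \<alpha> \<in> measurable M (count_space A)"

definition is_factor_map ::
  "'x measure \<Rightarrow> 'a set \<Rightarrow> ('x \<Rightarrow> 'a) \<Rightarrow> 'b set \<Rightarrow> ('x \<Rightarrow> 'b) \<Rightarrow> ('b \<Rightarrow> 'a) \<Rightarrow> bool" where
  "is_factor_map M A \<alpha> B \<beta> \<pi> \<longleftrightarrow> \<pi> \<in> B \<rightarrow> A \<and> (AE x in M. \<pi> (\<beta> x) = \<alpha> x)"

definition refines ::
  "'x measure \<Rightarrow> 'a set \<Rightarrow> ('x \<Rightarrow> 'a) \<Rightarrow> 'b set \<Rightarrow> ('x \<Rightarrow> 'b) \<Rightarrow> bool" where
  "refines M A \<alpha> B \<beta> \<longleftrightarrow> (\<exists>\<pi>. is_factor_map M A \<alpha> B \<beta> \<pi>)"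

text \<open>The map \<open>\<pi>\<close> is determined by \<open>\<alpha>\<close> and \<open>\<beta>\<close> on the letters of \<open>B\<close> that \<open>\<beta>\<close> attains with positive
  probability; we fix an arbitrary choice on the others.\<close>

definition factor_map ::
  "'x measure \<Rightarrow> 'a set \<Rightarrow> ('x \<Rightarrow> 'a) \<Rightarrow> 'b set \<Rightarrow> ('x \<Rightarrow> 'b) \<Rightarrow> 'b \<Rightarrow> 'a" where
  "factor_map M A \<alpha> B \<beta> = (SOME \<pi>. is_factor_map M A \<alpha> B \<beta> \<pi>)"

text \<open>Below, \<open>T :: 'g \<Rightarrow> 'x \<Rightarrow> 'x\<close> is an action, given by maps that satisfy the action identities
  almost everywhere.\<close>

definition itinerary ::
  "('g, 'm) monoid_scheme \<Rightarrow> ('g \<Rightarrow> 'x \<Rightarrow> 'x) \<Rightarrow> ('x \<Rightarrow> 'b) \<Rightarrow> 'g set \<Rightarrow> 'x \<Rightarrow> 'g \<Rightarrow> 'b" where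
  "itinerary G T \<beta> F x = (\<lambda>g\<in>F. \<beta> (T (inv\<^bsub>G\<^esub> g) x))"

definition AP ::
  "('g, 'm) monoid_scheme \<Rightarrow> 'x measure \<Rightarrow> ('g \<Rightarrow> 'x \<Rightarrow> 'x) \<Rightarrow> 'b set \<Rightarrow> ('x \<Rightarrow> 'b) \<Rightarrow> 'g set \<Rightarrow> real \<Rightarrow>
   nat \<Rightarrow> ('g \<Rightarrow> nat \<Rightarrow> nat) \<Rightarrow> (nat \<Rightarrow> 'g \<Rightarrow> 'b) set" where
  "AP G M T B \<beta> F \<delta> n s = {\<phi> \<in> {1..n} \<rightarrow>\<^sub>E (F \<rightarrow>\<^sub>E B).
     (\<Sum>b \<in> F \<rightarrow>\<^sub>E B. \<bar>measure (unif n) (\<phi> -` {b} \<inter> {1..n})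
                        - measure M (itinerary G T \<beta> F -` {b} \<inter> space M)\<bar>) < \<delta> \<and>
     (\<forall>g\<in>F. measure (unif n) {j \<in> {1..n}. \<phi> j g \<noteq> \<phi> (inv_into UNIV (s g) j) \<one>\<^bsub>G\<^esub>} < \<delta>)}"

definition log_count :: "nat \<Rightarrow> ereal" where
  "log_count n = (if n = 0 then -\<infinity> else ereal (ln (real n)))"

definition entropy_at ::
  "('g, 'm) monoid_scheme \<Rightarrow> (nat \<Rightarrow> nat) \<Rightarrow> (nat \<Rightarrow> 'g \<Rightarrow> nat \<Rightarrow> nat) \<Rightarrow> 'x measure \<Rightarrow>
   ('g \<Rightarrow> 'x \<Rightarrow> 'x) \<Rightarrow> 'a set \<Rightarrow> ('x \<Rightarrow> 'a) \<Rightarrow> 'b set \<Rightarrow> ('x \<Rightarrow> 'b) \<Rightarrow> 'g set \<Rightarrow> real \<Rightarrow> ereal" where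
  "entropy_at G d \<sigma> M T A \<alpha> B \<beta> F \<delta> =
     limsup (\<lambda>i. ereal (1 / real (d i)) * log_count (card
       (compose {1..d i} (\<lambda>b. factor_map M A \<alpha> B \<beta> (b \<one>\<^bsub>G\<^esub>)) ` AP G M T B \<beta> F \<delta> (d i) (\<sigma> i))))"

definition relative_entropy ::
  "('g, 'm) monoid_scheme \<Rightarrow> (nat \<Rightarrow> nat) \<Rightarrow> (nat \<Rightarrow> 'g \<Rightarrow> nat \<Rightarrow> nat) \<Rightarrow> 'x measure \<Rightarrow>
   ('g \<Rightarrow> 'x \<Rightarrow> 'x) \<Rightarrow> 'a set \<Rightarrow> ('x \<Rightarrow> 'a) \<Rightarrow> 'b set \<Rightarrow> ('x \<Rightarrow> 'b) \<Rightarrow> ereal" where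
  "relative_entropy G d \<sigma> M T A \<alpha> B \<beta> =
     (INF F \<in> {F. finite F \<and> F \<subseteq> carrier G \<and> \<one>\<^bsub>G\<^esub> \<in> F}. INF \<delta> \<in> {0<..}.
        entropy_at G d \<sigma> M T A \<alpha> B \<beta> F \<delta>)"

text \<open>Every finite alphabet is in bijection with a set of natural numbers, and relabelling letters
  does not affect \<^const>\<open>relative_entropy\<close>, so the alphabets range over finite sets of naturals.\<close>

definition sofic_entropy ::
  "('g, 'm) monoid_scheme \<Rightarrow> (nat \<Rightarrow> nat) \<Rightarrow> (nat \<Rightarrow> 'g \<Rightarrow> nat \<Rightarrow> nat) \<Rightarrow> 'x measure \<Rightarrow>
   ('g \<Rightarrow> 'x \<Rightarrow> 'x) \<Rightarrow> ereal" where
  "sofic_entropy G d \<sigma> M T =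
     (SUP (A :: nat set, \<alpha>) \<in> {(A, \<alpha>). finite_observable M A \<alpha>}.
      INF (B :: nat set, \<beta>) \<in> {(B, \<beta>). finite_observable M B \<beta> \<and> refines M A \<alpha> B \<beta>}.
        relative_entropy G d \<sigma> M T A \<alpha> B \<beta>)"

text \<open>The choice of representatives of the classes \<open>\<theta> g\<close> is immaterial: \<^const>\<open>sofic_entropy\<close> depends
  on the action only through measures of preimages.\<close>

definition action_of :: "('g \<Rightarrow> ('x \<Rightarrow> 'x) set) \<Rightarrow> 'g \<Rightarrow> 'x \<Rightarrow> 'x" where
  "action_of \<theta> g = aut_rep (\<theta> g)"

end

theory Submission
  imports Defs
begin

text \<open>Take \<open>\<beta> = \<alpha>\<close> for a finite observable \<open>\<alpha>\<close>. The image of \<open>\<Gamma>\<close> is totally bounded and \<open>\<Gamma>\<close> is infinite, so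
  by the pigeonhole principle infinitely many elements of \<open>\<Gamma>\<close> almost preserve all level sets of \<open>\<alpha>\<close>.
  Let \<open>F\<close> consist of the identity and \<open>N\<close> such elements, which move the observable by much less than
  \<open>1 / N\<close>. The labelling \<open>j \<mapsto> \<phi> j e\<close> of an approximate partition \<open>\<phi>\<close> is then invariant, off a small
  proportion of points, under \<open>N\<close> permutations which by soficity send most points to \<open>N\<close> distinct points.
  Such a labelling is determined by its values on the small exceptional set and on about \<open>d / N\<close>
  further points, so the number of labellings has arbitrarily small exponential growth rate.\<close>

section \<open>Counting almost invariant labellings of a finite set\<close>

text \<open>An exponential weight argument: give each subset \<open>J\<close> the weight
  \<open>t ^ card J\<close>. As \<open>t\<close> is at most 1, every small \<open>J\<close> weighs
  at least \<open>t powr (r * card D)\<close>, while all subsets together weigh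
  \<open>(1 + t) ^ card D\<close>. The parameter \<open>t\<close> stays free so that it can be fixed
  before \<open>r\<close>, which makes the rate \<open>t + r * ln (1 / t)\<close> as small as
  desired.\<close>

lemma card_small_subsets_le:
  fixes t r :: real
  assumes D: "finite D" and t: "0 < t" "t \<le> 1"
  shows "real (card {J \<in> Pow D. real (card J) \<le> r * card D})
    \<le> exp (card D * (t + r * ln (1 / t)))"
proof -
  let ?n = "real (card D)" and ?\<J> = "{J \<in> Pow D. real (card J) \<le> r * card D}"
  have "t powr (r * ?n) * real (card ?\<J>) = (\<Sum>J\<in>?\<J>. t powr (r * ?n))"
    by simp
  also have "\<dots> \<le> (\<Sum>J\<in>?\<J>. t ^ card J)"
    using t by (intro sum_mono) (auto simp flip: powr_realpow intro: powr_mono')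
  also have "\<dots> \<le> (\<Sum>J\<in>Pow D. t ^ card J)"
    using D t by (intro sum_mono2) auto
  \<comment> \<open>Expanding the product of \<open>t + 1\<close> over \<open>D\<close> yields one
    summand for each subset.\<close>
  also have "\<dots> = (1 + t) ^ card D"
    using prod_add[OF D, of "\<lambda>_. t" "\<lambda>_. 1"] by (simp add: add.commute)
  also have "\<dots> \<le> exp t ^ card D"
    using t by (intro power_mono) auto
  also have "\<dots> = exp (?n * t)"
    by (simp add: exp_of_nat_mult)
  finally have "real (card ?\<J>) \<le> exp (?n * t) / t powr (r * ?n)"
    using t by (simp add: field_simps)
  also have "\<dots> = exp (?n * (t + r * ln (1 / t)))"
    using t by (simp add: powr_def ln_div field_simps flip: exp_diff)
  finally show ?thesis .
qed

text \<open>Take \<open>W\<close> maximal under inclusion: a \<open>v\<close> outside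
  \<open>W\<close> whose set met none of the chosen ones could be added. For \<open>v\<close> in
  \<open>W\<close>, nonemptiness of \<open>N v\<close> makes \<open>v\<close> its own
  witness.\<close>

lemma ex_maximal_disjoint_subset:
  assumes "finite V" and N: "\<And>v. v \<in> V \<Longrightarrow> N v \<noteq> {}"
  obtains W where "W \<subseteq> V" "disjoint_family_on N W" "\<And>v. v \<in> V \<Longrightarrow> \<exists>w\<in>W. N v \<inter> N w \<noteq> {}"
proof -
  let ?\<W> = "{W \<in> Pow V. disjoint_family_on N W}"
  have "{} \<in> ?\<W>" by (simp add: disjoint_family_on_def)
  then have "?\<W> \<noteq> {}" by blast
  moreover have "finite ?\<W>" using assms by simp
  ultimately have "\<exists>W\<in>?\<W>. \<forall>W'\<in>?\<W>. W \<subseteq> W' \<longrightarrow> W = W'"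
    by (rule finite_has_maximal[rotated])
  then obtain W where W: "W \<in> ?\<W>" and max: "\<forall>W'\<in>?\<W>. W \<subseteq> W' \<longrightarrow> W = W'"
    by (rule bexE)
  have "\<exists>w\<in>W. N v \<inter> N w \<noteq> {}" if v: "v \<in> V" for v
  proof (cases "v \<in> W")
    case True
    then show ?thesis using N[OF v] by blast
  next
    case False
    have "insert v W \<notin> ?\<W>"
    proof
      assume "insert v W \<in> ?\<W>"
      with max have "W \<subseteq> insert v W \<longrightarrow> W = insert v W" by (rule bspec)
      then show False using False by auto
    qed
    then show ?thesis using W v by (auto simp: disjoint_family_on_def)
  qed
  then show ?thesis using that W by blast
qed

text \<open>Off the exceptional set \<open>J\<close> of \<open>\<psi>\<close>, the function \<open>\<psi>\<close> takes the same value at two points whose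
  sets of images under the maps \<open>p k\<close> meet. A maximal family of points outside \<open>J\<close> with disjoint image
  sets has at most \<open>card D / card K\<close> members, and the values of \<open>\<psi>\<close> on it and on \<open>J\<close> determine \<open>\<psi>\<close>.\<close>

lemma card_almost_invariant_functions_le:
  fixes p :: "'k \<Rightarrow> 'v \<Rightarrow> 'v" and t r :: real and A :: "'a set"
  defines "exc \<equiv> \<lambda>D K \<psi>. {j \<in> D. \<not> inj_on (\<lambda>k. p k j) K \<or> (\<exists>k\<in>K. \<psi> (p k j) \<noteq> (\<psi> j :: 'a))}"
  assumes D: "finite D" and K: "finite K" "K \<noteq> {}" and A: "finite A" "A \<noteq> {}"
    and p: "\<And>k j. k \<in> K \<Longrightarrow> j \<in> D \<Longrightarrow> p k j \<in> D"
    and t: "0 < t" "t \<le> 1"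
  shows "real (card {\<psi> \<in> D \<rightarrow>\<^sub>E A. real (card (exc D K \<psi>)) \<le> r * card D})
    \<le> exp (card D * (t + r * ln (1 / t) + (r + 1 / card K) * ln (card A)))"
proof -
  let ?n = "real (card D)" and ?a = "real (card A)"
  define N where "N j = (\<lambda>k. p k j) ` K" for j
  \<comment> \<open>Injectivity off \<open>J\<close> is part of the definition so that
    \<open>N j\<close> has exactly \<open>card K\<close> elements for \<open>j\<close> outside
    \<open>J\<close>; the packing bound for \<open>W J\<close> rests on this.\<close>
  define \<J> where "\<J> = {J \<in> Pow D. real (card J) \<le> r * card D \<and> (\<forall>j\<in>D - J. inj_on (\<lambda>k. p k j) K)}"
  \<comment> \<open>The family is chosen from \<open>J\<close> alone, so two functions with the same
    exceptional set are compared on the same \<open>W J\<close>.\<close>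
  have "\<exists>W. W \<subseteq> D - J \<and> disjoint_family_on N W \<and> (\<forall>v\<in>D - J. \<exists>w\<in>W. N v \<inter> N w \<noteq> {})" for J
    using ex_maximal_disjoint_subset[of "D - J" N] D K by (metis N_def finite_Diff image_is_empty)
  then obtain W where W: "\<And>J. W J \<subseteq> D - J" "\<And>J. disjoint_family_on N (W J)"
    "\<And>J v. v \<in> D - J \<Longrightarrow> \<exists>w\<in>W J. N v \<inter> N w \<noteq> {}"
    by metis
  have a1: "?a \<ge> 1"
    using A by (simp add: Suc_le_eq card_gt_0_iff)
  have fin\<J>: "finite \<J>"
    using D by (simp add: \<J>_def)
  have finJ: "finite (J \<union> W J)" if "J \<in> \<J>" for J
    using that D W(1)[of J] by (auto simp: \<J>_def intro: finite_subset)
  have cardJ: "real (card (J \<union> W J)) \<le> ?n * (r + 1 / card K)" if J: "J \<in> \<J>" for J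
  proof -
    have finW: "finite (W J)" using D W(1)[of J] by (auto intro: finite_subset)
    \<comment> \<open>Packing: the sets \<open>N w\<close> are disjoint, of size
      \<open>card K\<close>, and lie in \<open>D\<close>.\<close>
    have "card (W J) * card K = (\<Sum>w\<in>W J. card (N w))"
      using J W(1)[of J] by (simp add: N_def \<J>_def card_image subset_eq)
    also have "\<dots> = card (\<Union>w\<in>W J. N w)"
      using finW K W(2)[of J]
      by (subst card_UN_disjoint) (auto simp: N_def disjoint_family_on_def)
    also have "\<dots> \<le> card D"
      using W(1)[of J] p by (intro card_mono[OF D]) (auto simp: N_def)
    finally have "real (card (W J)) * real (card K) \<le> ?n"
      by (simp flip: of_nat_mult)
    then have "real (card (W J)) \<le> ?n / card K"
      using K by (simp add: field_simps card_gt_0_iff)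
    moreover have "real (card (J \<union> W J)) \<le> real (card J) + real (card (W J))"
      using card_Un_le[of J "W J"] by linarith
    ultimately show ?thesis
      using J by (simp add: \<J>_def algebra_simps)
  qed
  let ?\<Psi> = "{\<psi> \<in> D \<rightarrow>\<^sub>E A. real (card (exc D K \<psi>)) \<le> r * card D}"
  let ?code = "\<lambda>\<psi>. (exc D K \<psi>, restrict \<psi> (exc D K \<psi> \<union> W (exc D K \<psi>)))"
  let ?S = "SIGMA J:\<J>. (J \<union> W J) \<rightarrow>\<^sub>E A"
  have "inj_on ?code ?\<Psi>"
  proof (rule inj_onI)
    fix \<psi> \<psi>' assume \<psi>: "\<psi> \<in> ?\<Psi>" and \<psi>': "\<psi>' \<in> ?\<Psi>" and eq: "?code \<psi> = ?code \<psi>'"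
    define J where "J = exc D K \<psi>"
    have J': "exc D K \<psi>' = J" using eq by (simp add: J_def)
    have "restrict \<psi> (J \<union> W J) = restrict \<psi>' (J \<union> W J)"
      using eq unfolding J' J_def[symmetric] prod.inject by blast
    then have on: "\<psi> j = \<psi>' j" if "j \<in> J \<union> W J" for j
      using that by (metis restrict_apply')
    have "\<psi> j = \<psi>' j" if j: "j \<in> D" for j
    proof (cases "j \<in> J")
      case False
      then obtain w k l where w: "w \<in> W J" and kl: "k \<in> K" "l \<in> K" "p k j = p l w"
        using W(3)[of j J] j by (auto simp: N_def)
      have "w \<in> D" "w \<notin> J" using W(1) w by auto
      have inv: "\<psi> (p k j) = \<psi> j" "\<psi> (p l w) = \<psi> w"
        using \<open>w \<in> D\<close> \<open>w \<notin> J\<close> False j kl by (auto simp: J_def exc_def)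
      have inv': "\<psi>' (p k j) = \<psi>' j" "\<psi>' (p l w) = \<psi>' w"
        using \<open>w \<in> D\<close> \<open>w \<notin> J\<close> False j kl by (auto simp: J'[symmetric] exc_def)
      show ?thesis using on[of w] w kl inv inv' by auto
    qed (simp add: on)
    then show "\<psi> = \<psi>'" using \<psi> \<psi>' by (blast intro: PiE_ext)
  qed
  moreover have "?code ` ?\<Psi> \<subseteq> ?S"
  proof (intro image_subsetI)
    fix \<psi> assume \<psi>: "\<psi> \<in> ?\<Psi>"
    have "exc D K \<psi> \<in> \<J>" using \<psi> by (auto simp: \<J>_def exc_def)
    moreover have "exc D K \<psi> \<union> W (exc D K \<psi>) \<subseteq> D" using W(1) by (auto simp: exc_def)
    ultimately show "?code \<psi> \<in> ?S" using \<psi> by auto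
  qed
  moreover have "finite ?S"
    using fin\<J> finJ A by (intro finite_SigmaI finite_PiE) auto
  ultimately have "card ?\<Psi> \<le> card ?S"
    by (rule card_inj_on_le)
  also have "card ?S = (\<Sum>J\<in>\<J>. card ((J \<union> W J) \<rightarrow>\<^sub>E A))"
    using fin\<J> finJ A by (intro card_SigmaI) (auto intro!: finite_PiE)
  finally have "real (card ?\<Psi>) \<le> (\<Sum>J\<in>\<J>. real (card ((J \<union> W J) \<rightarrow>\<^sub>E A)))"
    by (simp flip: of_nat_sum)
  also have "\<dots> = (\<Sum>J\<in>\<J>. ?a powr card (J \<union> W J))"
    using finJ a1 by (intro sum.cong) (auto simp: card_PiE powr_realpow)
  also have "\<dots> \<le> (\<Sum>J\<in>\<J>. ?a powr (?n * (r + 1 / card K)))"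
    using cardJ a1 by (intro sum_mono powr_mono) auto
  also have "\<dots> = real (card \<J>) * ?a powr (?n * (r + 1 / card K))"
    by simp
  also have "\<dots> \<le> exp (?n * (t + r * ln (1 / t))) * ?a powr (?n * (r + 1 / card K))"
  proof (rule mult_right_mono)
    have "card \<J> \<le> card {J \<in> Pow D. real (card J) \<le> r * card D}"
      using D by (intro card_mono) (auto simp: \<J>_def)
    then show "real (card \<J>) \<le> exp (?n * (t + r * ln (1 / t)))"
      using card_small_subsets_le[OF D t, of r] by linarith
  qed simp
  also have "\<dots> = exp (?n * (t + r * ln (1 / t) + (r + 1 / card K) * ln ?a))"
    using a1 by (simp add: powr_def algebra_simps flip: exp_add)
  finally show ?thesis .
qed

section \<open>Representatives and preimages of classes of automorphisms\<close>

lemma aut_preimage_sets: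
  assumes "a \<in> carrier (Aut M)" "A \<in> sets M"
  shows "aut_preimage M a A \<in> sets M"
  using aut_rep_mem(2)[OF assms(1)] assms(2)
  by (auto simp: aut_preimage_def mp_bij_def intro: measurable_sets)

text \<open>Representatives are arbitrary choices, hence multiplicative only almost everywhere: the
  composite of two of them lies in the product coset, whose members all agree almost
  everywhere.\<close>

lemma aut_rep_mult:
  assumes a: "a \<in> carrier (Aut M)" and b: "b \<in> carrier (Aut M)"
  shows "AE x in M. aut_rep (a \<otimes>\<^bsub>Aut M\<^esub> b) x = aut_rep a (aut_rep b x)"
proof -
  interpret A: group "Aut M" by (rule group_Aut)
  let ?S = "aut_rep a" and ?T = "aut_rep b"
  have ab: "a \<otimes>\<^bsub>Aut M\<^esub> b \<in> carrier (Aut M)" using a b by simp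
  have S: "?S \<in> a" "?S \<in> mp_bij M" and T: "?T \<in> b" "?T \<in> mp_bij M"
    using aut_rep_mem a b by auto
  have "?S \<otimes>\<^bsub>mp_group M\<^esub> ?T \<in> a \<otimes>\<^bsub>Aut M\<^esub> b"
    using S T by (auto simp: Aut_def FactGroup_def set_mult_def)
  then have C: "compose (space M) ?S ?T \<in> a \<otimes>\<^bsub>Aut M\<^esub> b"
    using S T by (simp add: mult_mp_group)
  obtain R where R: "a \<otimes>\<^bsub>Aut M\<^esub> b = {S \<in> mp_bij M. AE x in M. S x = R x}"
    using ab unfolding mem_Aut_iff by (rule bexE)
  have "AE x in M. compose (space M) ?S ?T x = R x" "AE x in M. aut_rep (a \<otimes>\<^bsub>Aut M\<^esub> b) x = R x"
    using C aut_rep_mem(1)[OF ab] unfolding R by auto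
  then show ?thesis
    using AE_space by eventually_elim (simp add: compose_def)
qed

lemma measure_aut_preimage:
  assumes "a \<in> carrier (Aut M)" "A \<in> sets M"
  shows "measure M (aut_preimage M a A) = measure M A"
proof -
  have T: "aut_rep a \<in> measurable M M" "distr M M (aut_rep a) = M"
    using aut_rep_mem(2)[OF assms(1)] by (auto simp: mp_bij_def)
  show ?thesis
    using measure_distr[OF T(1) assms(2)] by (simp add: T(2) aut_preimage_def)
qed

lemma aut_preimage_mult_AE:
  assumes a: "a \<in> carrier (Aut M)" and b: "b \<in> carrier (Aut M)"
  shows "AE x in M. x \<in> aut_preimage M (a \<otimes>\<^bsub>Aut M\<^esub> b) A \<longleftrightarrow>
    x \<in> aut_preimage M b (aut_preimage M a A)"
proof -
  have "aut_rep b \<in> measurable M M" using aut_rep_mem(2)[OF b] by (simp add: mp_bij_def)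
  then have space: "aut_rep b x \<in> space M" if "x \<in> space M" for x
    using that by (rule measurable_space)
  show ?thesis
    using aut_rep_mult[OF a b] AE_space by eventually_elim (auto simp: aut_preimage_def space)
qed

section \<open>The weak topology and compactness\<close>

context prob_space
begin

text \<open>For a fixed event \<open>A\<close> this is a pseudometric on \<open>Aut M\<close>; the
  basic weak neighborhoods are finite intersections of its balls.\<close>

definition aut_dist :: "'a set \<Rightarrow> ('a \<Rightarrow> 'a) set \<Rightarrow> ('a \<Rightarrow> 'a) set \<Rightarrow> real" where
  "aut_dist A a b = prob (sym_diff (aut_preimage M a A) (aut_preimage M b A))"

lemma aut_dist_commute: "aut_dist A a b = aut_dist A b a"
  by (simp add: aut_dist_def Un_commute)

lemma aut_dist_triangle:
  assumes "a \<in> carrier (Aut M)" "b \<in> carrier (Aut M)" "c \<in> carrier (Aut M)" "A \<in> events"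
  shows "aut_dist A a c \<le> aut_dist A a b + aut_dist A b c"
proof -
  let ?P = "\<lambda>a. aut_preimage M a A"
  have m: "?P a \<in> events" "?P b \<in> events" "?P c \<in> events"
    using assms aut_preimage_sets by blast+
  have "aut_dist A a c \<le> prob (sym_diff (?P a) (?P b) \<union> sym_diff (?P b) (?P c))"
    unfolding aut_dist_def using m by (intro finite_measure_mono) auto
  also have "\<dots> \<le> aut_dist A a b + aut_dist A b c"
    unfolding aut_dist_def using m by (intro measure_Un_le) auto
  finally show ?thesis .
qed

text \<open>Taking preimages reverses products, so multiplying by \<open>c\<close> on the right
  pulls the symmetric difference back along \<open>c\<close>, which preserves its measure.
  Multiplying on the left would instead replace \<open>A\<close> by its preimage under
  \<open>c\<close>.\<close>

lemma aut_dist_mult_right: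
  assumes a: "a \<in> carrier (Aut M)" and b: "b \<in> carrier (Aut M)" and c: "c \<in> carrier (Aut M)"
    and A: "A \<in> events"
  shows "aut_dist A (a \<otimes>\<^bsub>Aut M\<^esub> c) (b \<otimes>\<^bsub>Aut M\<^esub> c) = aut_dist A a b"
proof -
  interpret A: group "Aut M" by (rule group_Aut)
  let ?P = "\<lambda>a. aut_preimage M a A"
  let ?D = "sym_diff (?P a) (?P b)"
  have m: "?P a \<in> events" "?P b \<in> events" "?P (a \<otimes>\<^bsub>Aut M\<^esub> c) \<in> events" "?P (b \<otimes>\<^bsub>Aut M\<^esub> c) \<in> events"
    using assms aut_preimage_sets A.m_closed by blast+
  then have D: "?D \<in> events" by auto
  have "aut_dist A (a \<otimes>\<^bsub>Aut M\<^esub> c) (b \<otimes>\<^bsub>Aut M\<^esub> c) = prob (aut_preimage M c ?D)"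
    unfolding aut_dist_def
  proof (rule finite_measure_eq_AE)
    show "AE x in M. x \<in> sym_diff (?P (a \<otimes>\<^bsub>Aut M\<^esub> c)) (?P (b \<otimes>\<^bsub>Aut M\<^esub> c)) \<longleftrightarrow> x \<in> aut_preimage M c ?D"
      using aut_preimage_mult_AE[OF a c, of A] aut_preimage_mult_AE[OF b c, of A]
      by eventually_elim (auto simp: aut_preimage_def)
    show "aut_preimage M c ?D \<in> events" using c D by (rule aut_preimage_sets)
  qed (use m in auto)
  also have "\<dots> = aut_dist A a b"
    unfolding aut_dist_def by (rule measure_aut_preimage[OF c D])
  finally show ?thesis .
qed

text \<open>Open sets are defined as those containing a basic neighborhood of each of their points,
  so openness of the basic neighborhoods themselves has to come from the triangle
  inequality.\<close>

lemma openin_weak_nbhd: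
  assumes a: "a \<in> carrier (Aut M)" and \<A>: "finite \<A>" "\<A> \<subseteq> events"
  shows "openin (weak_topology M) (weak_nbhd M a \<A> \<epsilon>)"
  unfolding openin_weak_topology
proof (intro conjI ballI)
  show "weak_nbhd M a \<A> \<epsilon> \<subseteq> carrier (Aut M)" by (auto simp: weak_nbhd_def)
  fix b assume "b \<in> weak_nbhd M a \<A> \<epsilon>"
  then have b: "b \<in> carrier (Aut M)" "\<And>A. A \<in> \<A> \<Longrightarrow> aut_dist A b a < \<epsilon>"
    by (auto simp: weak_nbhd_def aut_dist_def)
  \<comment> \<open>The least slack over the sets in \<open>\<A>\<close>; the extra 1 keeps the
    minimum meaningful when \<open>\<A>\<close> is empty.\<close>
  define \<eta> where "\<eta> = Min (insert 1 ((\<lambda>A. \<epsilon> - aut_dist A b a) ` \<A>))"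
  have "\<eta> > 0" using \<A> b by (simp add: \<eta>_def)
  moreover have "weak_nbhd M b \<A> \<eta> \<subseteq> weak_nbhd M a \<A> \<epsilon>"
  proof
    fix c assume c: "c \<in> weak_nbhd M b \<A> \<eta>"
    have "aut_dist A c a < \<epsilon>" if A: "A \<in> \<A>" for A
    proof -
      have "aut_dist A c b < \<eta>" using c A by (simp add: weak_nbhd_def aut_dist_def)
      also have "\<eta> \<le> \<epsilon> - aut_dist A b a" using \<A> A by (simp add: \<eta>_def)
      finally show ?thesis
        using aut_dist_triangle[of c b a A] c b a A \<A> by (auto simp: weak_nbhd_def)
    qed
    then show "c \<in> weak_nbhd M a \<A> \<epsilon>" using c by (auto simp: weak_nbhd_def aut_dist_def)
  qed
  ultimately show "\<exists>\<B> \<delta>. finite \<B> \<and> \<B> \<subseteq> events \<and> \<delta> > 0 \<and> weak_nbhd M b \<B> \<delta> \<subseteq> weak_nbhd M a \<A> \<epsilon>"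
    using \<A> by blast
qed

text \<open>Finitely many neighborhoods of radius \<open>\<epsilon> / 2\<close> cover
  \<open>K\<close>, so one of them contains the images of infinitely many group elements, and any
  two of these images are within \<open>\<epsilon>\<close> of each other. A right translation moves
  them near the identity.\<close>

lemma infinite_near_identity:
  assumes G: "group G" "infinite (carrier G)" and \<alpha>: "\<alpha> \<in> hom G (Aut M)"
    and K: "compactin (weak_topology M) K" "\<alpha> ` carrier G \<subseteq> K"
    and \<A>: "finite \<A>" "\<A> \<subseteq> events" and \<epsilon>: "\<epsilon> > 0"
  shows "infinite {g \<in> carrier G. \<forall>A\<in>\<A>. aut_dist A (\<alpha> g) (\<alpha> \<one>\<^bsub>G\<^esub>) < \<epsilon>}"
proof -
  interpret G: group G by (rule G)
  have \<alpha>c: "\<alpha> g \<in> carrier (Aut M)" if "g \<in> carrier G" for g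
    using \<alpha> that by (auto simp: hom_def)
  let ?\<U> = "(\<lambda>a. weak_nbhd M a \<A> (\<epsilon> / 2)) ` K"
  have KA: "K \<subseteq> carrier (Aut M)"
    using compactin_subset_topspace[OF K(1)] by (auto simp: topspace_def openin_weak_topology)
  have "K \<subseteq> \<Union>?\<U>"
    using KA \<epsilon> by (force simp: weak_nbhd_def)
  moreover have "openin (weak_topology M) U" if "U \<in> ?\<U>" for U
    using that KA \<A> by (auto intro: openin_weak_nbhd)
  ultimately obtain \<F> where \<F>: "finite \<F>" "\<F> \<subseteq> ?\<U>" "K \<subseteq> \<Union>\<F>"
    using compactinD[OF K(1), of ?\<U>] by metis
  have "\<forall>g\<in>carrier G. \<exists>U\<in>\<F>. \<alpha> g \<in> U" using \<F> K(2) by blast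
  then obtain U where U: "U \<in> \<F>" and inf: "infinite {g \<in> carrier G. \<alpha> g \<in> U}"
    using pigeonhole_infinite_rel[OF G(2) \<F>(1), of "\<lambda>g U. \<alpha> g \<in> U"] by blast
  then obtain a where a: "a \<in> K" "U = weak_nbhd M a \<A> (\<epsilon> / 2)" using \<F> by blast
  have near: "aut_dist A (\<alpha> g) (\<alpha> h) < \<epsilon>"
    if "g \<in> carrier G" "h \<in> carrier G" "\<alpha> g \<in> U" "\<alpha> h \<in> U" "A \<in> \<A>" for g h A
  proof -
    have "aut_dist A (\<alpha> g) a < \<epsilon> / 2" "aut_dist A (\<alpha> h) a < \<epsilon> / 2"
      using that by (auto simp: a(2) weak_nbhd_def aut_dist_def)
    then show ?thesis
      using aut_dist_triangle[of "\<alpha> g" a "\<alpha> h" A] aut_dist_commute[of A a "\<alpha> h"] that \<alpha>c a KA \<A>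
      by (auto simp: subset_eq)
  qed
  obtain h where h: "h \<in> carrier G" "\<alpha> h \<in> U"
    using inf not_finite_existsD by blast
  let ?f = "\<lambda>g. g \<otimes>\<^bsub>G\<^esub> inv\<^bsub>G\<^esub> h"
  have "inj_on ?f {g \<in> carrier G. \<alpha> g \<in> U}"
    using h by (auto simp: inj_on_def)
  then have "infinite (?f ` {g \<in> carrier G. \<alpha> g \<in> U})"
    using inf by (simp add: finite_image_iff)
  moreover have "?f ` {g \<in> carrier G. \<alpha> g \<in> U}
    \<subseteq> {g \<in> carrier G. \<forall>A\<in>\<A>. aut_dist A (\<alpha> g) (\<alpha> \<one>\<^bsub>G\<^esub>) < \<epsilon>}"
  proof (intro image_subsetI CollectI conjI ballI)
    fix g A assume g: "g \<in> {g \<in> carrier G. \<alpha> g \<in> U}" and A: "A \<in> \<A>"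
    \<comment> \<open>Right multiplication by \<open>\<alpha> h\<close> does not change the distance
      and turns the two arguments into \<open>\<alpha> g\<close> and
      \<open>\<alpha> h\<close>.\<close>
    have "aut_dist A (\<alpha> (?f g)) (\<alpha> \<one>\<^bsub>G\<^esub>)
      = aut_dist A (\<alpha> (?f g) \<otimes>\<^bsub>Aut M\<^esub> \<alpha> h) (\<alpha> \<one>\<^bsub>G\<^esub> \<otimes>\<^bsub>Aut M\<^esub> \<alpha> h)"
      using g h A \<A> by (subst aut_dist_mult_right) (auto intro: \<alpha>c)
    also have "\<dots> = aut_dist A (\<alpha> g) (\<alpha> h)"
      using g h by (simp add: hom_mult[OF \<alpha>, symmetric] G.m_assoc)
    also have "\<dots> < \<epsilon>" using near g h A by blast
    finally show "aut_dist A (\<alpha> (?f g)) (\<alpha> \<one>\<^bsub>G\<^esub>) < \<epsilon>" .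
  qed (use h in auto)
  ultimately show ?thesis using finite_subset by blast
qed

end

section \<open>Distinct images under a sofic approximation\<close>

lemma measure_unif:
  "X \<subseteq> {1..n} \<Longrightarrow> measure (unif n) X = card X / n"
  by (subst measure_uniform_count_measure) auto

text \<open>Injectivity fails at \<open>j\<close> only if two distinct elements of \<open>S\<close>
  agree there. There are finitely many such pairs, and by soficity each eventually accounts for a
  small proportion of points.\<close>

lemma sofic_eventually_inj_on:
  fixes r :: real
  assumes sofic: "sofic_approximation G d \<sigma>" and S: "finite S" "S \<subseteq> carrier G" and r: "r > 0"
  shows "\<forall>\<^sub>F i in sequentially.
    card {j \<in> {1..d i}. \<not> inj_on (\<lambda>g. inv_into UNIV (\<sigma> i g) j) S} \<le> r * d i"
proof -
  define P where "P = {(g, h) \<in> S \<times> S. g \<noteq> h}"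
  have finP: "finite P" using S by (auto simp: P_def intro: finite_subset[of _ "S \<times> S"])
  \<comment> \<open>The summand 1 keeps the quotient positive when \<open>S\<close> has no two
    distinct elements.\<close>
  define q where "q = r / (card P + 1)"
  have q: "q > 0" "card P * q \<le> r" using r by (auto simp: q_def field_simps)
  let ?D = "\<lambda>i. {1..d i}" and ?p = "\<lambda>i g j. inv_into UNIV (\<sigma> i g) j"
  let ?E = "\<lambda>i (g, h). {j \<in> ?D i. ?p i g j = ?p i h j}"
  have "\<forall>\<^sub>F i in sequentially. \<forall>x\<in>P. real (card (?E i x)) \<le> q * d i"
  proof (rule eventually_ball_finite[OF finP], rule ballI)
    fix x assume x: "x \<in> P"
    obtain g h where gh: "x = (g, h)" by (cases x)
    then have g: "g \<in> carrier G" and h: "h \<in> carrier G" and ne: "g \<noteq> h" using x S by (auto simp: P_def)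
    let ?X = "\<lambda>i. {k \<in> ?D i. \<sigma> i g k \<noteq> \<sigma> i h k}"
    have "(\<lambda>i. measure (unif (d i)) (?X i)) \<longlonglongrightarrow> 1"
      using sofic g h ne by (simp add: sofic_approximation_def)
    then have "\<forall>\<^sub>F i in sequentially. measure (unif (d i)) (?X i) > 1 - q"
      using q by (intro order_tendstoD) auto
    then show "\<forall>\<^sub>F i in sequentially. real (card (?E i x)) \<le> q * d i"
      unfolding gh
    proof eventually_elim
      case (elim i)
      have d: "d i \<ge> 1" and pg: "\<sigma> i g permutes ?D i" and ph: "\<sigma> i h permutes ?D i"
        using sofic g h by (auto simp: sofic_approximation_def)
      have "measure (unif (d i)) (?X i) = card (?X i) / d i"
        by (rule measure_unif) auto
      with elim have "1 - q < card (?X i) / d i" by simp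
      then have 1: "real (card (?X i)) > (1 - q) * d i"
        using d by (simp add: pos_less_divide_eq)
      \<comment> \<open>Soficity speaks of the permutations, \<open>AP\<close> of their inverses: if
        both inverses send \<open>j\<close> to \<open>k\<close>, then both permutations send
        \<open>k\<close> to \<open>j\<close>.\<close>
      have "?E i (g, h) \<subseteq> \<sigma> i g ` (?D i - ?X i)"
      proof
        fix j assume "j \<in> ?E i (g, h)"
        then have j: "j \<in> ?D i" and eq: "?p i g j = ?p i h j" by auto
        have "?p i g j \<in> ?D i" using permutes_in_image[OF permutes_inv[OF pg]] j by simp
        moreover have "\<sigma> i g (?p i g j) = j" by (rule permutes_inverses(1)[OF pg])
        moreover have "\<sigma> i h (?p i g j) = j" unfolding eq by (rule permutes_inverses(1)[OF ph])
        ultimately show "j \<in> \<sigma> i g ` (?D i - ?X i)"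
          by (intro image_eqI[of _ _ "?p i g j"]) auto
      qed
      then have "card (?E i (g, h)) \<le> card (?D i - ?X i)"
        by (intro surj_card_le) auto
      also have "\<dots> = d i - card (?X i)"
        by (subst card_Diff_subset) auto
      finally have "card (?E i (g, h)) \<le> d i - card (?X i)" .
      moreover have "card (?X i) \<le> card (?D i)" by (intro card_mono) auto
      ultimately have "card (?E i (g, h)) + card (?X i) \<le> d i" by simp
      then have "real (card (?E i (g, h))) \<le> real (d i) - real (card (?X i))"
        by (simp only: le_diff_eq of_nat_le_iff flip: of_nat_add)
      then show ?case using 1 by (simp add: algebra_simps)
    qed
  qed
  then show ?thesis
  proof eventually_elim
    case (elim i)
    have "card {j \<in> ?D i. \<not> inj_on (\<lambda>g. ?p i g j) S} \<le> card (\<Union>x\<in>P. ?E i x)"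
      using finP by (intro card_mono) (auto simp: inj_on_def P_def)
    also have "\<dots> \<le> (\<Sum>x\<in>P. card (?E i x))" by (rule card_UN_le[OF finP])
    finally have "real (card {j \<in> ?D i. \<not> inj_on (\<lambda>g. ?p i g j) S}) \<le> (\<Sum>x\<in>P. real (card (?E i x)))"
      by (simp flip: of_nat_sum)
    also have "\<dots> \<le> (\<Sum>x\<in>P. q * d i)" using elim by (intro sum_mono) auto
    also have "\<dots> = card P * q * d i" by simp
    also have "\<dots> \<le> r * d i" using q by (intro mult_right_mono) auto
    finally show ?case .
  qed
qed

section \<open>Almost invariance of the labellings given by approximate partitions\<close>

text \<open>Both labels are compared with \<open>\<phi> j g\<close>. One comparison fails on a
  proportion below \<open>\<delta>\<close> by approximate equivariance. The other is an event about
  the letters of \<open>\<phi> j\<close>, whose distribution is \<open>\<delta>\<close>-close to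
  that of the itinerary; hence \<open>2 * \<delta>\<close>. The point \<open>x\<close> is moved by
  the map for the inverse of the identity because this is what the identity coordinate of the
  itinerary records.\<close>

lemma (in prob_space) AP_mismatch_le:
  fixes \<beta> :: "'a \<Rightarrow> 'b"
  assumes \<phi>: "\<phi> \<in> AP G M T B \<beta> F \<delta> n s" and n: "n \<ge> 1"
    and F: "finite F" "g \<in> F" "\<one>\<^bsub>G\<^esub> \<in> F" and B: "finite B"
    and meas: "\<And>g. g \<in> F \<Longrightarrow> (\<lambda>x. \<beta> (T (inv\<^bsub>G\<^esub> g) x)) \<in> measurable M (count_space B)"
  shows "real (card {j \<in> {1..n}. \<phi> (inv_into UNIV (s g) j) \<one>\<^bsub>G\<^esub> \<noteq> \<phi> j \<one>\<^bsub>G\<^esub>})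
    \<le> (prob {x \<in> space M. \<beta> (T (inv\<^bsub>G\<^esub> g) x) \<noteq> \<beta> (T (inv\<^bsub>G\<^esub> \<one>\<^bsub>G\<^esub>) x)} + 2 * \<delta>) * n"
proof -
  let ?D = "{1..n}" and ?e = "\<one>\<^bsub>G\<^esub>" and ?X = "F \<rightarrow>\<^sub>E B"
  let ?I = "itinerary G T \<beta> F"
  let ?m = "prob {x \<in> space M. \<beta> (T (inv\<^bsub>G\<^esub> g) x) \<noteq> \<beta> (T (inv\<^bsub>G\<^esub> ?e) x)}"
  define Y where "Y = {b \<in> ?X. b g \<noteq> b ?e}"
  have finX: "finite ?X" using F B by (auto intro: finite_PiE)
  have fPi: "\<phi> j \<in> ?X" if "j \<in> ?D" for j using \<phi> that by (auto simp: AP_def)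
  have close: "(\<Sum>b\<in>?X. \<bar>measure (unif n) (\<phi> -` {b} \<inter> ?D) - prob (?I -` {b} \<inter> space M)\<bar>) < \<delta>"
    and equiv: "measure (unif n) {j \<in> ?D. \<phi> j g \<noteq> \<phi> (inv_into UNIV (s g) j) ?e} < \<delta>"
    using \<phi> F by (auto simp: AP_def)
  have I_meas: "?I -` {b} \<inter> space M \<in> events" if b: "b \<in> ?X" for b
  proof -
    \<comment> \<open>Both sides are extensional on \<open>F\<close>, so equality can be tested at
      each coordinate, which makes the preimage a finite intersection.\<close>
    have "?I x = b \<longleftrightarrow> (\<forall>h\<in>F. \<beta> (T (inv\<^bsub>G\<^esub> h) x) = b h)" for x
    proof
      assume "\<forall>h\<in>F. \<beta> (T (inv\<^bsub>G\<^esub> h) x) = b h"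
      then show "?I x = b"
        using b by (intro extensionalityI[of _ F]) (auto simp: itinerary_def PiE_def)
    qed (auto simp: itinerary_def)
    then have "?I -` {b} \<inter> space M = (\<Inter>h\<in>F. (\<lambda>x. \<beta> (T (inv\<^bsub>G\<^esub> h) x)) -` {b h} \<inter> space M)"
      using F by auto
    also have "\<dots> \<in> events"
      using F b by (intro sets.finite_INT measurable_sets[OF meas]) auto
    finally show ?thesis .
  qed
  have ne_meas: "{x \<in> space M. \<beta> (T (inv\<^bsub>G\<^esub> g) x) \<noteq> \<beta> (T (inv\<^bsub>G\<^esub> ?e) x)} \<in> events"
  proof -
    have [measurable]: "(\<lambda>x. \<beta> (T (inv\<^bsub>G\<^esub> g) x)) \<in> measurable M (count_space B)"
      "(\<lambda>x. \<beta> (T (inv\<^bsub>G\<^esub> ?e) x)) \<in> measurable M (count_space B)" using meas F by auto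
    have "{x \<in> space M. \<beta> (T (inv\<^bsub>G\<^esub> g) x) \<noteq> \<beta> (T (inv\<^bsub>G\<^esub> ?e) x)} =
      (\<Union>b\<in>B. ((\<lambda>x. \<beta> (T (inv\<^bsub>G\<^esub> g) x)) -` {b} \<inter> space M) - ((\<lambda>x. \<beta> (T (inv\<^bsub>G\<^esub> ?e) x)) -` {b} \<inter> space M))"
      using meas[OF F(2), THEN measurable_space] by auto
    also have "\<dots> \<in> events"
      using B F by (intro sets.finite_UN sets.Diff measurable_sets[OF meas]) auto
    finally show ?thesis .
  qed
  have "measure (unif n) {j \<in> ?D. \<phi> j g \<noteq> \<phi> j ?e} = (\<Sum>b\<in>Y. measure (unif n) (\<phi> -` {b} \<inter> ?D))"
  proof -
    have "card {j \<in> ?D. \<phi> j g \<noteq> \<phi> j ?e} = card (\<Union>b\<in>Y. \<phi> -` {b} \<inter> ?D)"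
      using fPi by (intro arg_cong[of _ _ card]) (auto simp: Y_def)
    also have "\<dots> = (\<Sum>b\<in>Y. card (\<phi> -` {b} \<inter> ?D))"
      using finX by (intro card_UN_disjoint) (auto simp: Y_def)
    finally have "card {j \<in> ?D. \<phi> j g \<noteq> \<phi> j ?e} = (\<Sum>b\<in>Y. card (\<phi> -` {b} \<inter> ?D))" .
    moreover have "measure (unif n) {j \<in> ?D. \<phi> j g \<noteq> \<phi> j ?e} = card {j \<in> ?D. \<phi> j g \<noteq> \<phi> j ?e} / n"
      by (rule measure_unif) auto
    moreover have "measure (unif n) (\<phi> -` {b} \<inter> ?D) = card (\<phi> -` {b} \<inter> ?D) / n" for b
      by (rule measure_unif) auto
    ultimately show ?thesis by (simp only: sum_divide_distrib of_nat_sum)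
  qed
  also have "\<dots> \<le> (\<Sum>b\<in>Y. prob (?I -` {b} \<inter> space M)
      + \<bar>measure (unif n) (\<phi> -` {b} \<inter> ?D) - prob (?I -` {b} \<inter> space M)\<bar>)"
    by (intro sum_mono) linarith
  also have "\<dots> \<le> (\<Sum>b\<in>Y. prob (?I -` {b} \<inter> space M)) + \<delta>"
  proof -
    have "(\<Sum>b\<in>Y. \<bar>measure (unif n) (\<phi> -` {b} \<inter> ?D) - prob (?I -` {b} \<inter> space M)\<bar>) \<le> \<delta>"
      using sum_mono2[OF finX, of Y "\<lambda>b. \<bar>measure (unif n) (\<phi> -` {b} \<inter> ?D) - prob (?I -` {b} \<inter> space M)\<bar>"]
        close by (simp add: Y_def)
    then show ?thesis by (simp add: sum.distrib)
  qed
  finally have *: "measure (unif n) {j \<in> ?D. \<phi> j g \<noteq> \<phi> j ?e} \<le> (\<Sum>b\<in>Y. prob (?I -` {b} \<inter> space M)) + \<delta>" .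
  have "(\<Sum>b\<in>Y. prob (?I -` {b} \<inter> space M)) = prob (\<Union>b\<in>Y. ?I -` {b} \<inter> space M)"
    using finX I_meas
    by (intro finite_measure_finite_Union[symmetric]) (auto simp: Y_def disjoint_family_on_def)
  also have "\<dots> \<le> ?m"
    using ne_meas F by (intro finite_measure_mono) (auto simp: Y_def itinerary_def)
  finally have "measure (unif n) {j \<in> ?D. \<phi> j g \<noteq> \<phi> j ?e} \<le> ?m + \<delta>" using * by linarith
  moreover have "measure (unif n) {j \<in> ?D. \<phi> j g \<noteq> \<phi> j ?e} = card {j \<in> ?D. \<phi> j g \<noteq> \<phi> j ?e} / n"
    by (rule measure_unif) auto
  ultimately have "card {j \<in> ?D. \<phi> j g \<noteq> \<phi> j ?e} \<le> (?m + \<delta>) * n"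
    using n by (simp add: pos_divide_le_eq)
  moreover have "card {j \<in> ?D. \<phi> j g \<noteq> \<phi> (inv_into UNIV (s g) j) ?e} \<le> \<delta> * n"
  proof -
    have "measure (unif n) {j \<in> ?D. \<phi> j g \<noteq> \<phi> (inv_into UNIV (s g) j) ?e}
      = card {j \<in> ?D. \<phi> j g \<noteq> \<phi> (inv_into UNIV (s g) j) ?e} / n"
      by (rule measure_unif) auto
    with equiv show ?thesis using n by (simp add: pos_divide_less_eq)
  qed
  moreover have "card {j \<in> ?D. \<phi> (inv_into UNIV (s g) j) ?e \<noteq> \<phi> j ?e}
    \<le> card ({j \<in> ?D. \<phi> j g \<noteq> \<phi> j ?e} \<union> {j \<in> ?D. \<phi> j g \<noteq> \<phi> (inv_into UNIV (s g) j) ?e})"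
    by (intro card_mono) auto
  moreover have "\<dots> \<le> card {j \<in> ?D. \<phi> j g \<noteq> \<phi> j ?e} + card {j \<in> ?D. \<phi> j g \<noteq> \<phi> (inv_into UNIV (s g) j) ?e}"
    by (rule card_Un_le)
  ultimately show ?thesis by (simp add: algebra_simps)
qed

text \<open>Where the two values differ, the level set of the first value contains exactly one of
  the two image points, so \<open>x\<close> lies in the symmetric difference for that level
  set.\<close>

lemma (in prob_space) prob_observable_neq_le:
  assumes obs: "finite_observable M A f" and a: "a \<in> carrier (Aut M)" and b: "b \<in> carrier (Aut M)"
  shows "prob {x \<in> space M. f (aut_rep a x) \<noteq> f (aut_rep b x)}
    \<le> (\<Sum>c\<in>A. aut_dist (f -` {c} \<inter> space M) a b)"
proof -
  let ?C = "\<lambda>c. f -` {c} \<inter> space M"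
  let ?S = "\<lambda>c. sym_diff (aut_preimage M a (?C c)) (aut_preimage M b (?C c))"
  have finA: "finite A" and f: "f \<in> measurable M (count_space A)"
    using obs by (auto simp: finite_observable_def)
  have S: "?S c \<in> events" if "c \<in> A" for c
    using that measurable_sets[OF f, of "{c}"] a b by (auto intro!: aut_preimage_sets)
  have space: "aut_rep a x \<in> space M" "aut_rep b x \<in> space M" if "x \<in> space M" for x
    using that aut_rep_mem(2)[OF a] aut_rep_mem(2)[OF b] by (auto simp: mp_bij_def measurable_space)
  have "prob {x \<in> space M. f (aut_rep a x) \<noteq> f (aut_rep b x)} \<le> prob (\<Union>c\<in>A. ?S c)"
  proof (rule finite_measure_mono)
    show "(\<Union>c\<in>A. ?S c) \<in> events" using S finA by blast
    show "{x \<in> space M. f (aut_rep a x) \<noteq> f (aut_rep b x)} \<subseteq> (\<Union>c\<in>A. ?S c)"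
    proof clarify
      fix x assume x: "x \<in> space M" "f (aut_rep a x) \<noteq> f (aut_rep b x)"
      then have "x \<in> ?S (f (aut_rep a x))" using space by (simp add: aut_preimage_def)
      moreover have "f (aut_rep a x) \<in> A" using measurable_space[OF f space(1)[OF x(1)]] by simp
      ultimately show "x \<in> (\<Union>c\<in>A. ?S c)" by blast
    qed
  qed
  also have "\<dots> \<le> (\<Sum>c\<in>A. prob (?S c))"
    using finA S by (intro measure_UNION_le) auto
  finally show ?thesis by (simp add: aut_dist_def)
qed

section \<open>The entropy estimate\<close>

text \<open>For \<open>c = 0\<close> the left side is minus infinity only because the factor is
  positive: in \<open>ereal\<close>, zero times minus infinity is zero.\<close>

lemma log_count_mean_le:
  assumes "real c \<le> exp (real n * e)" "n \<ge> 1"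
  shows "ereal (1 / real n) * log_count c \<le> ereal e"
proof (cases "c = 0")
  case False
  then have "ln (real c) \<le> ln (exp (real n * e))"
    using assms(1) by (intro ln_mono) auto
  then show ?thesis
    using False assms(2) by (simp add: log_count_def field_simps)
qed (use assms(2) in \<open>simp add: log_count_def\<close>)

text \<open>The exponent in the labelling count is split into \<open>t\<close>, at most
  \<open>\<epsilon> / 4\<close>, the terms with \<open>r\<close>, at most
  \<open>\<epsilon> / 2\<close>, and \<open>L / N\<close>, at most \<open>\<epsilon> / 4\<close>.
  The order of choice matters: \<open>r\<close> depends on \<open>t\<close>, and the tolerances
  depend on \<open>r\<close> and \<open>N\<close>.\<close>

lemma (in prob_space) relative_entropy_self_le:
  fixes f :: "'a \<Rightarrow> 'c" and \<alpha> :: "'g \<Rightarrow> ('a \<Rightarrow> 'a) set" and G :: "('g, 'm) monoid_scheme"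
  assumes G: "group G" "infinite (carrier G)" and sofic: "sofic_approximation G d \<sigma>"
    and \<alpha>: "\<alpha> \<in> hom G (Aut M)"
    and K: "compactin (weak_topology M) K" "\<alpha> ` carrier G \<subseteq> K"
    and obs: "finite_observable M A f" and \<epsilon>: "\<epsilon> > 0"
  shows "relative_entropy G d \<sigma> M (action_of \<alpha>) A f A f \<le> ereal \<epsilon>"
proof -
  interpret G: group G by (rule G)
  let ?T = "action_of \<alpha>" and ?e = "\<one>\<^bsub>G\<^esub>"
  have finA: "finite A" and f: "f \<in> measurable M (count_space A)"
    using obs by (auto simp: finite_observable_def)
  have Ane: "A \<noteq> {}" using measurable_space[OF f] not_empty by auto
  have \<alpha>c: "\<alpha> g \<in> carrier (Aut M)" if "g \<in> carrier G" for g
    using \<alpha> that by (auto simp: hom_def)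
  define L where "L = ln (real (card A))"
  have A0: "real (card A) > 0" using finA Ane by (simp add: card_gt_0_iff)
  have L: "L \<ge> 0" using finA Ane by (simp add: L_def card_gt_0_iff Suc_le_eq)
  define t where "t = min 1 (\<epsilon> / 4)"
  have t: "0 < t" "t \<le> 1" "t \<le> \<epsilon> / 4" using \<epsilon> by (auto simp: t_def)
  have lt: "ln (1 / t) \<ge> 0" using t by simp
  \<comment> \<open>The summand 1 keeps the denominator positive when \<open>t = 1\<close> and
    \<open>A\<close> has a single letter.\<close>
  define r where "r = \<epsilon> / 2 / (ln (1 / t) + L + 1)"
  have r: "r > 0" using \<epsilon> lt L by (simp add: r_def)
  have r': "r * ln (1 / t) + r * L \<le> \<epsilon> / 2"
  proof -
    have "r * (ln (1 / t) + L) \<le> r * (ln (1 / t) + L + 1)" using r by simp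
    also have "\<dots> = \<epsilon> / 2"
      unfolding r_def using lt L by (intro nonzero_eq_divide_eq[THEN iffD1, OF _ refl]) linarith
    finally show ?thesis by (simp add: algebra_simps)
  qed
  define N where "N = nat \<lceil>4 * L / \<epsilon>\<rceil> + 1"
  have N: "N \<ge> 1" "1 / real N * L \<le> \<epsilon> / 4"
  proof -
    have "4 * L / \<epsilon> \<le> real N" unfolding N_def by linarith
    then show "1 / real N * L \<le> \<epsilon> / 4" using \<epsilon> by (simp add: N_def field_simps)
  qed (simp add: N_def)
  \<comment> \<open>With these tolerances
    \<open>card A * \<eta> + 2 * \<delta> = r / (2 * N)\<close>, so the \<open>N\<close> elements
    together cost at most \<open>r / 2\<close>. The other half of \<open>r\<close> is left for
    failures of injectivity.\<close>
  define \<eta> where "\<eta> = r / (4 * N * card A)"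
  define \<delta> where "\<delta> = r / (8 * N)"
  have \<eta>: "\<eta> > 0" "card A * \<eta> = r / (4 * N)" and \<delta>: "\<delta> > 0" using r N A0 by (auto simp: \<eta>_def \<delta>_def)
  let ?\<A> = "(\<lambda>c. f -` {c} \<inter> space M) ` A"
  have "infinite {g \<in> carrier G. \<forall>B\<in>?\<A>. aut_dist B (\<alpha> g) (\<alpha> ?e) < \<eta>}"
    using finA measurable_sets[OF f] \<eta> by (intro infinite_near_identity[OF G \<alpha> K]) auto
  then obtain U where U: "U \<subseteq> {g \<in> carrier G. \<forall>B\<in>?\<A>. aut_dist B (\<alpha> g) (\<alpha> ?e) < \<eta>}"
    "finite U" "card U = N"
    using infinite_arbitrarily_large[of _ N] by blast
  \<comment> \<open>Inverses are taken because coordinate \<open>g\<close> of an itinerary applies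
    the inverse of \<open>g\<close>.\<close>
  define S where "S = (\<lambda>g. inv\<^bsub>G\<^esub> g) ` U"
  have "inj_on (\<lambda>g. inv\<^bsub>G\<^esub> g) U"
    using U by (intro inj_on_inverseI[where g = "\<lambda>g. inv\<^bsub>G\<^esub> g"]) auto
  then have S: "finite S" "S \<subseteq> carrier G" "card S = N"
    using U by (auto simp: S_def card_image)
  then have Sne: "S \<noteq> {}" using N by auto
  define F where "F = insert ?e S"
  have F: "finite F" "F \<subseteq> carrier G" "?e \<in> F" using S by (auto simp: F_def)
  have meas: "(\<lambda>x. f (?T (inv\<^bsub>G\<^esub> g) x)) \<in> measurable M (count_space A)" if "g \<in> F" for g
  proof -
    have "?T (inv\<^bsub>G\<^esub> g) \<in> measurable M M"
      using aut_rep_mem(2)[OF \<alpha>c, of "inv\<^bsub>G\<^esub> g"] that F by (auto simp: action_of_def mp_bij_def)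
    from measurable_comp[OF this f] show ?thesis by (simp add: comp_def)
  qed
  have near: "prob {x \<in> space M. f (?T (inv\<^bsub>G\<^esub> g) x) \<noteq> f (?T (inv\<^bsub>G\<^esub> ?e) x)} + 2 * \<delta> \<le> r / (2 * N)"
    if g: "g \<in> S" for g
  proof -
    obtain u where u: "u \<in> U" "g = inv\<^bsub>G\<^esub> u" using g by (auto simp: S_def)
    then have uc: "u \<in> carrier G" using U by auto
    have "prob {x \<in> space M. f (?T (inv\<^bsub>G\<^esub> g) x) \<noteq> f (?T (inv\<^bsub>G\<^esub> ?e) x)}
      \<le> (\<Sum>c\<in>A. aut_dist (f -` {c} \<inter> space M) (\<alpha> u) (\<alpha> ?e))"
      using prob_observable_neq_le[OF obs \<alpha>c[OF uc] \<alpha>c[OF G.one_closed]] u uc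
      by (simp add: action_of_def)
    also have "\<dots> \<le> (\<Sum>c\<in>A. \<eta>)"
      using U u by (intro sum_mono) (auto intro: less_imp_le)
    finally show ?thesis using \<eta> by (simp add: \<delta>_def)
  qed
  let ?p = "\<lambda>i g j. inv_into UNIV (\<sigma> i g) j" and ?D = "\<lambda>i. {1..d i}"
  let ?AP = "\<lambda>i. AP G M ?T A f F \<delta> (d i) (\<sigma> i)" and ?\<pi> = "factor_map M A f A f"
  have "\<forall>\<^sub>F i in sequentially. ereal (1 / real (d i)) * log_count (card
       (compose (?D i) (\<lambda>b. ?\<pi> (b ?e)) ` ?AP i)) \<le> ereal \<epsilon>"
    using sofic_eventually_inj_on[OF sofic S(1,2), OF half_gt_zero[OF r]]
  proof eventually_elim
    case (elim i)
    have d: "d i \<ge> 1" and perm: "\<sigma> i g permutes ?D i" if "g \<in> carrier G" for g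
      using sofic that by (auto simp: sofic_approximation_def)
    define exc where "exc \<psi> = {j \<in> ?D i. \<not> inj_on (\<lambda>g. ?p i g j) S \<or> (\<exists>g\<in>S. \<psi> (?p i g j) \<noteq> \<psi> j)}"
      for \<psi> :: "nat \<Rightarrow> 'c"
    let ?\<Psi> = "{\<psi> \<in> ?D i \<rightarrow>\<^sub>E A. real (card (exc \<psi>)) \<le> r * card (?D i)}"
    let ?r = "\<lambda>\<phi>. \<lambda>j\<in>?D i. \<phi> j ?e"
    have p: "?p i g j \<in> ?D i" if "g \<in> S" "j \<in> ?D i" for g j
      using that S permutes_in_image[OF permutes_inv[OF perm]] by blast
    have sub: "?r ` ?AP i \<subseteq> ?\<Psi>"
    proof (intro image_subsetI CollectI conjI)
      fix \<phi> assume \<phi>: "\<phi> \<in> ?AP i"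
      then have fPi: "\<phi> j \<in> F \<rightarrow>\<^sub>E A" if "j \<in> ?D i" for j using that by (auto simp: AP_def)
      show "?r \<phi> \<in> ?D i \<rightarrow>\<^sub>E A" using fPi F by fastforce
      let ?I = "{j \<in> ?D i. \<not> inj_on (\<lambda>g. ?p i g j) S}"
      let ?E = "\<lambda>g. {j \<in> ?D i. \<phi> (?p i g j) ?e \<noteq> \<phi> j ?e}"
      have E: "real (card (?E g)) \<le> r / (2 * N) * d i" if g: "g \<in> S" for g
      proof -
        have "real (card (?E g))
          \<le> (prob {x \<in> space M. f (?T (inv\<^bsub>G\<^esub> g) x) \<noteq> f (?T (inv\<^bsub>G\<^esub> ?e) x)} + 2 * \<delta>) * d i"
          using g d F finA meas by (intro AP_mismatch_le[OF \<phi>]) (auto simp: F_def)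
        also have "\<dots> \<le> r / (2 * N) * d i"
          using near[OF g] by (intro mult_right_mono) auto
        finally show ?thesis .
      qed
      \<comment> \<open>An exceptional point either has coinciding images or sees its label change
        under some element of \<open>S\<close>.\<close>
      have "card (exc (?r \<phi>)) \<le> card (?I \<union> (\<Union>g\<in>S. ?E g))"
        using S p by (intro card_mono) (auto simp: exc_def)
      also have "\<dots> \<le> card ?I + card (\<Union>g\<in>S. ?E g)" by (rule card_Un_le)
      also have "card (\<Union>g\<in>S. ?E g) \<le> (\<Sum>g\<in>S. card (?E g))" by (rule card_UN_le[OF S(1)])
      finally have "real (card (exc (?r \<phi>))) \<le> real (card ?I) + (\<Sum>g\<in>S. real (card (?E g)))"
        by (simp flip: of_nat_sum of_nat_add)
      also have "\<dots> \<le> r / 2 * d i + (\<Sum>g\<in>S. r / (2 * N) * d i)"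
        using elim E by (intro add_mono sum_mono) auto
      also have "\<dots> = r * d i" using S N by simp
      finally show "real (card (exc (?r \<phi>))) \<le> r * card (?D i)" by simp
    qed
    have fin\<Psi>: "finite ?\<Psi>"
      using finA by (intro finite_subset[OF _ finite_PiE[of "?D i" "\<lambda>_. A"]]) auto
    \<comment> \<open>The chosen factor map need not be the identity on letters of probability zero.
      Applying it to labellings cannot increase their number, so it suffices to count them
      beforehand.\<close>
    have "compose (?D i) (\<lambda>b. ?\<pi> (b ?e)) ` ?AP i = compose (?D i) ?\<pi> ` ?r ` ?AP i"
      unfolding image_image by (intro image_cong) (auto simp: compose_def)
    then have "card (compose (?D i) (\<lambda>b. ?\<pi> (b ?e)) ` ?AP i) \<le> card (?r ` ?AP i)"
      using finite_subset[OF sub fin\<Psi>] by (simp add: card_image_le)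
    also have "\<dots> \<le> card ?\<Psi>" by (rule card_mono[OF fin\<Psi> sub])
    also have "real (card ?\<Psi>)
      \<le> exp (card (?D i) * (t + r * ln (1 / t) + (r + 1 / card S) * ln (card A)))"
      unfolding exc_def using S Sne finA Ane p t
      by (intro card_almost_invariant_functions_le) auto
    also have "\<dots> \<le> exp (d i * \<epsilon>)"
    proof -
      have "t + r * ln (1 / t) + (r + 1 / card S) * ln (card A) \<le> \<epsilon>"
        unfolding S(3) L_def[symmetric] distrib_right using t(3) r' N(2) by linarith
      then show ?thesis by (simp add: mult_left_mono)
    qed
    finally show ?case
      using d[OF G.one_closed] by (intro log_count_mean_le) auto
  qed
  then have "entropy_at G d \<sigma> M ?T A f A f F \<delta> \<le> ereal \<epsilon>"
    unfolding entropy_at_def by (rule Limsup_bounded)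
  then show ?thesis
    unfolding relative_entropy_def using F \<delta> by (intro INF_lower2[of F] INF_lower2[of \<delta>]) auto
qed

theorem corollary1p4:
  fixes G :: "('g, 'm) monoid_scheme"
    and d :: "nat \<Rightarrow> nat" and \<sigma> :: "nat \<Rightarrow> 'g \<Rightarrow> nat \<Rightarrow> nat"
    and M :: "'x measure"
    and \<alpha> :: "'g \<Rightarrow> ('x \<Rightarrow> 'x) set" and K :: "('x \<Rightarrow> 'x) set set"
  assumes "group G" and "countable (carrier G)" and "infinite (carrier G)"
    and "sofic_approximation G d \<sigma>"
    and "standard_prob_space M"
    and "\<alpha> \<in> hom G (Aut M)"
    and "subgroup K (Aut M)" and "compactin (weak_topology M) K"
    and "\<alpha> ` carrier G \<subseteq> K"
  shows "sofic_entropy G d \<sigma> M (action_of \<alpha>) \<le> 0"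
proof -
  interpret prob_space M using assms(5) by (simp add: standard_prob_space_def)
  have "(INF (B :: nat set, \<beta>) \<in> {(B, \<beta>). finite_observable M B \<beta> \<and> refines M A f B \<beta>}.
      relative_entropy G d \<sigma> M (action_of \<alpha>) A f B \<beta>) \<le> 0"
    if obs: "finite_observable M A f" for A :: "nat set" and f
  proof (rule ereal_le_epsilon2)
    fix \<epsilon> :: real assume "\<epsilon> > 0"
    have "refines M A f A f"
      by (auto simp: refines_def is_factor_map_def intro: exI[of _ "\<lambda>a. a"])
    moreover have "relative_entropy G d \<sigma> M (action_of \<alpha>) A f A f \<le> ereal \<epsilon>"
      using assms obs \<open>\<epsilon> > 0\<close> by (intro relative_entropy_self_le) auto
    ultimately show "(INF (B :: nat set, \<beta>) \<in> {(B, \<beta>). finite_observable M B \<beta> \<and> refines M A f B \<beta>}.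
      relative_entropy G d \<sigma> M (action_of \<alpha>) A f B \<beta>) \<le> 0 + ereal \<epsilon>"
      using obs by (intro INF_lower2[where i = "(A, f)"]) auto
  qed
  then show ?thesis
    unfolding sofic_entropy_def by (intro SUP_least) auto
qed

end
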